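(* Let $p,q:\mathbb{R}\to\mathbb{R}$ be cyclic functions on the interval $[0,T]$, where $T$ is the period, with $p=q$. For $t\ge0$ let the state probabilities be $$\nu_-(t)=\frac12-\frac{\nu_+(0)-\nu_-(0)}{2}\exp\left\{-2\int_0^t p(s)\,ds\right\},\qquad \nu_+(t)=\frac12+\frac{\nu_+(0)-\nu_-(0)}{2}\exp\left\{-2\int_0^t p(s)\,ds\right\}.$$ Then the invariant measures are $$\overline{\nu}_-(t)=\overline{\nu}_+(t)=\frac12 .$$
   Context: $Y_t\in\{-1,+1\}$ is a two-state continuous time Markov chain. The probability of a transition from $-1$ to $+1$ in a small time interval $[t,t+dt]$ is $\sim p(t)\,dt$, and that of a transition from $+1$ to $-1$ is $\sim q(t)\,dt$; here $p=q$. The state probabilities $\nu_\pm(t)=P(Y_t=\pm1)$ satisfy $\nu_-'=-p\,\nu_-+q\,\nu_+$, $\nu_+'=p\,\nu_--q\,\nu_+$ and $\nu_-(t)+\nu_+(t)=1$ for all $t$, with initial values $\nu_\pm(0)$ at $t=0$. The invariant measure is defined by $\overline{\nu}_\pm(t):=\lim_{N\to\infty}\nu_\pm(NT+t)$, where $N$ is an integer number of periods.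
   Formalization: It is assumed in addition that p is integrable on [0,T] with strictly positive integral over a period; without positivity the claim fails, e.g. for p=q=0 and ν_+(0)=1, where the limits are 0 and 1. *)

theory Defs
  imports "HOL-Probability.Probability" "HOL-Library.Periodic_Fun"
begin

text \<open>
  Time is indexed by \<^typ>\<open>real\<close>, but only times \<open>t \<ge> 0\<close> are constrained. Measurability into
  \<open>count_space {-1, 1}\<close> includes the requirement that the process takes only the values
  \<open>-1\<close> and \<open>1\<close>.

  Conditional probabilities are only constrained when the conditioning event has positive
  probability, because \<^const>\<open>cond_prob\<close> is \<open>0\<close> otherwise. The initial law may
  be concentrated in one state.

  The rate assumptions say that the probability of a transition during \<open>[t, t + h]\<close> is
  \<open>p t * h + o(h)\<close>, respectively \<open>q t * h + o(h)\<close>, as \<open>h\<close> decreases to \<open>0\<close>.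
\<close>

locale two_state_markov_chain = prob_space M
  for M :: "'a measure" +
  fixes Y :: "real \<Rightarrow> 'a \<Rightarrow> int" and p q :: "real \<Rightarrow> real"
  assumes state: "\<And>t. 0 \<le> t \<Longrightarrow> Y t \<in> measurable M (count_space {-1, 1})"
    and markov: "\<And>s t U x y z.
      \<lbrakk>0 \<le> s; s \<le> t; finite U; U \<subseteq> {0..<s};
       \<P>(\<omega> in M. Y s \<omega> = x \<and> (\<forall>u\<in>U. Y u \<omega> = y u)) > 0\<rbrakk> \<Longrightarrow>
       \<P>(\<omega> in M. Y t \<omega> = z \<bar> Y s \<omega> = x \<and> (\<forall>u\<in>U. Y u \<omega> = y u))
         = \<P>(\<omega> in M. Y t \<omega> = z \<bar> Y s \<omega> = x)"
    and rates_nonneg: "\<And>t. 0 \<le> t \<Longrightarrow> 0 \<le> p t \<and> 0 \<le> q t"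
    and rate_up: "\<And>t. \<lbrakk>0 \<le> t; \<P>(\<omega> in M. Y t \<omega> = -1) > 0\<rbrakk> \<Longrightarrow>
      ((\<lambda>h. \<P>(\<omega> in M. Y (t + h) \<omega> = 1 \<bar> Y t \<omega> = -1) / h) \<longlongrightarrow> p t) (at_right 0)"
    and rate_down: "\<And>t. \<lbrakk>0 \<le> t; \<P>(\<omega> in M. Y t \<omega> = 1) > 0\<rbrakk> \<Longrightarrow>
      ((\<lambda>h. \<P>(\<omega> in M. Y (t + h) \<omega> = -1 \<bar> Y t \<omega> = 1) / h) \<longlongrightarrow> q t) (at_right 0)"

definition state_prob :: "'a measure \<Rightarrow> (real \<Rightarrow> 'a \<Rightarrow> int) \<Rightarrow> int \<Rightarrow> real \<Rightarrow> real" where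
  "state_prob M Y x t = \<P>(\<omega> in M. Y t \<omega> = x)"

text \<open>
  \<^const>\<open>lim\<close> is unspecified for a divergent sequence, so statements about the value of
  \<open>invariant_measure\<close> should come with convergence of the sequence.
\<close>

definition invariant_measure ::
    "'a measure \<Rightarrow> (real \<Rightarrow> 'a \<Rightarrow> int) \<Rightarrow> real \<Rightarrow> int \<Rightarrow> real \<Rightarrow> real" where
  "invariant_measure M Y T x t = lim (\<lambda>N::nat. state_prob M Y x (real N * T + t))"

end

theory Submission
  imports Defs
begin

text \<open>Each period contributes the same amount I > 0 to the integral
  (\<open>has_integral_periodic\<close>), and since rates are nonnegative the remaining stretch of
  length \<open>t\<close> cannot undo this. The integral is therefore at least \<open>N * I\<close>,
  and the exponential tends to 0 (\<open>tendsto_exp_neg_integral_periodic\<close>): the initial law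
  is forgotten. Positivity of I matters, since a vanishing rate would freeze the initial
  law.\<close>

text \<open>Translation by \<open>N * T\<close> carries the first period to the next one to be
  appended. Using \<open>has_integral\<close> lets the induction deliver integrability on
  \<open>{0..real N * T}\<close> together with the value.\<close>

lemma has_integral_periodic:
  fixes f :: "real \<Rightarrow> real"
  assumes "periodic_fun_simple f T" and T: "0 < T" and f: "(f has_integral I) {0..T}"
  shows "(f has_integral (real N * I)) {0..real N * T}"
proof (induction N)
  case 0
  then show ?case using has_integral_refl(2)[of f 0] by simp
next
  case (Suc N)
  interpret periodic_fun_simple f T by fact
  have "f \<circ> (+) (real N * T) = f"
    by (simp add: fun_eq_iff add.commute[of "real N * T"] plus_of_nat)
  then have "(f has_integral I) {real N * T..real N * T + T}"
    using has_integral_shift_Icc_real[of f "real N * T" I 0 T] f by (simp add: add.commute)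
  with Suc.IH have "(f has_integral (real N * I + I)) {0..real N * T + T}"
    using T by (intro has_integral_combine) auto
  then show ?case by (simp add: algebra_simps)
qed

lemma tendsto_exp_neg_integral_periodic:
  fixes f :: "real \<Rightarrow> real"
  assumes per: "periodic_fun_simple f T" and T: "0 < T" and f: "f integrable_on {0..T}"
    and pos: "0 < integral {0..T} f" and nonneg: "\<And>x. 0 \<le> x \<Longrightarrow> 0 \<le> f x" and t: "0 \<le> t"
  shows "(\<lambda>N. exp (- 2 * integral {0..real N * T + t} f)) \<longlonglongrightarrow> 0"
proof -
  define I where "I = integral {0..T} f"
  have hi: "(f has_integral (real N * I)) {0..real N * T}" for N
    using has_integral_periodic[OF per T] f by (simp add: I_def integrable_integral)
  have lower: "real N * I \<le> integral {0..real N * T + t} f" for N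
  proof -
    \<comment> \<open>Integrability is assumed on one period only; it reaches
      \<open>real N * T + t\<close> by restriction from \<open>K\<close> whole periods. It has to be
      secured because \<open>integral\<close> defaults to 0 on non-integrable functions, which would
      break the monotonicity used next.\<close>
    obtain K where "real N * T + t < real K * T"
      using T reals_Archimedean3 by blast
    then have "f integrable_on {0..real N * T + t}"
      using integrable_on_subinterval[OF has_integral_integrable[OF hi[of K]]] by auto
    then have "integral {0..real N * T} f \<le> integral {0..real N * T + t} f"
      using has_integral_integrable[OF hi[of N]] nonneg t by (intro integral_subset_le) simp_all
    then show ?thesis
      using integral_unique[OF hi[of N]] by simp
  qed
  have "filterlim (\<lambda>N. real N * I) at_top sequentially"
    using pos unfolding I_def
    by (rule filterlim_at_top_mult_tendsto_pos[OF tendsto_const _ filterlim_real_sequentially])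
  then have "filterlim (\<lambda>N. integral {0..real N * T + t} f) at_top sequentially"
    by (rule filterlim_at_top_mono) (simp add: lower)
  then have "filterlim (\<lambda>N. 2 * integral {0..real N * T + t} f) at_top sequentially"
    by (rule filterlim_tendsto_pos_mult_at_top[OF tendsto_const, rotated]) simp
  then have "filterlim (\<lambda>N. - 2 * integral {0..real N * T + t} f) at_bot sequentially"
    by (simp add: filterlim_uminus_at_bot)
  then show ?thesis
    by (rule filterlim_compose[OF exp_at_bot])
qed

theorem corollary3p4:
  fixes M :: "'a measure" and Y :: "real \<Rightarrow> 'a \<Rightarrow> int"
    and p q :: "real \<Rightarrow> real" and T :: real
  assumes chain: "two_state_markov_chain M Y p q"
    and period_pos: "0 < T"
    and cyclic_p: "periodic_fun_simple p T"
    and cyclic_q: "periodic_fun_simple q T"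
    and p_eq_q: "p = q"
    and integrable: "p integrable_on {0..T}"
    and nondegenerate: "0 < integral {0..T} p"
    and nu_minus: "\<And>t. 0 \<le> t \<Longrightarrow>
      state_prob M Y (-1) t
        = 1/2 - (state_prob M Y 1 0 - state_prob M Y (-1) 0) / 2 * exp (-2 * integral {0..t} p)"
    and nu_plus: "\<And>t. 0 \<le> t \<Longrightarrow>
      state_prob M Y 1 t
        = 1/2 + (state_prob M Y 1 0 - state_prob M Y (-1) 0) / 2 * exp (-2 * integral {0..t} p)"
  shows "\<forall>t\<ge>0.
      convergent (\<lambda>N::nat. state_prob M Y (-1) (real N * T + t)) \<and>
      convergent (\<lambda>N::nat. state_prob M Y 1 (real N * T + t)) \<and>
      invariant_measure M Y T (-1) t = 1/2 \<and>
      invariant_measure M Y T 1 t = 1/2"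
proof (intro allI impI)
  fix t :: real
  assume t: "0 \<le> t"
  interpret two_state_markov_chain M Y p q by fact
  define d where "d = (state_prob M Y 1 0 - state_prob M Y (-1) 0) / 2"
  \<comment> \<open>Nonnegativity of \<open>p\<close> on the half-line comes from the chain itself,
    through \<open>rates_nonneg\<close>.\<close>
  have e: "(\<lambda>N. exp (- 2 * integral {0..real N * T + t} p)) \<longlonglongrightarrow> 0"
    using cyclic_p period_pos integrable nondegenerate rates_nonneg t
    by (intro tendsto_exp_neg_integral_periodic) auto
  have nonneg: "0 \<le> real N * T + t" for N
    using period_pos t by simp
  \<comment> \<open>The limit is left as \<open>1/2 - d * 0\<close>, the shape produced by the limit
    rules; simplification then gives 1/2 whatever the initial imbalance \<open>d\<close>.\<close>
  have "(\<lambda>N. 1/2 - d * exp (- 2 * integral {0..real N * T + t} p)) \<longlonglongrightarrow> 1/2 - d * 0"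
    by (intro tendsto_intros e)
  then have minus: "(\<lambda>N. state_prob M Y (-1) (real N * T + t)) \<longlonglongrightarrow> 1/2"
    by (simp add: nu_minus[OF nonneg, folded d_def])
  have "(\<lambda>N. 1/2 + d * exp (- 2 * integral {0..real N * T + t} p)) \<longlonglongrightarrow> 1/2 + d * 0"
    by (intro tendsto_intros e)
  then have plus: "(\<lambda>N. state_prob M Y 1 (real N * T + t)) \<longlonglongrightarrow> 1/2"
    by (simp add: nu_plus[OF nonneg, folded d_def])
  show "convergent (\<lambda>N::nat. state_prob M Y (-1) (real N * T + t)) \<and>
      convergent (\<lambda>N::nat. state_prob M Y 1 (real N * T + t)) \<and>
      invariant_measure M Y T (-1) t = 1/2 \<and>
      invariant_measure M Y T 1 t = 1/2"
    using minus plus by (simp add: invariant_measure_def convergentI limI)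
qed

end
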